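(* Let $G$ be a group with neutral element $e$ and let $\mathcal{R} = \bigoplus_{g\in G} \mathcal{R}_g$ be a strongly $G$-graded ring, where $\mathcal{R}_e$ is commutative. If $C_{\mathcal{R}}(\mathcal{R}_e)$ is a $G$-simple ring (with respect to the canonical action), then $\mathcal{R}$ is a simple ring.
   Context: All rings are associative and unital; $G$ is an arbitrary group. A ring $\mathcal{R}$ is $G$-graded if $\mathcal{R}=\bigoplus_{g\in G}\mathcal{R}_g$ for additive subgroups $\mathcal{R}_g$ with $\mathcal{R}_g\mathcal{R}_h\subseteq \mathcal{R}_{gh}$ for all $g,h\in G$; it is strongly $G$-graded if moreover $\mathcal{R}_g\mathcal{R}_h=\mathcal{R}_{gh}$ for all $g,h\in G$, where $\mathcal{R}_g\mathcal{R}_h$ is the set of all finite sums of products $r_gr_h$ with $r_g\in\mathcal{R}_g$, $r_h\in\mathcal{R}_h$. For a subset $S\subseteq \mathcal{R}$, the commutant $C_{\mathcal{R}}(S)$ is the set of elements of $\mathcal{R}$ commuting with every element of $S$. Canonical action: in a strongly $G$-graded ring, $1_{\mathcal{R}}\in\mathcal{R}_e=\mathcal{R}_g\mathcal{R}_{g^{-1}}$, so for each $g\in G$ one can write $1_{\mathcal{R}}=\sum_{i=1}^{n_g}a_g^{(i)}b_{g^{-1}}^{(i)}$ with $a_g^{(i)}\in\mathcal{R}_g$, $b_{g^{-1}}^{(i)}\in\mathcal{R}_{g^{-1}}$. For $\lambda\in C_{\mathcal{R}}(\mathcal{R}_e)$ put $\sigma_g(\lambda)=\sum_{i=1}^{n_g}a_g^{(i)}\,\lambda\,b_{g^{-1}}^{(i)}$.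 This is independent of the choices, and $g\mapsto\sigma_g$ is an action of $G$ by ring automorphisms on $C_{\mathcal{R}}(\mathcal{R}_e)$, restricting to an action by ring automorphisms on the center $Z(\mathcal{R}_e)$; it is called the canonical action. Ideals are two-sided. A ring is simple if it has no ideals other than $\{0\}$ and itself. For a ring $A$ with an action $\sigma:G\to\mathrm{Aut}(A)$, an ideal $I$ of $A$ is $G$-invariant if $\sigma_g(I)\subseteq I$ for each $g\in G$; $A$ is $G$-simple if it has no $G$-invariant ideals other than $\{0\}$ and $A$. *)

theory Defs
  imports "HOL-Algebra.Algebra"
begin

locale graded_ring = G: group G + R: ring R
  for G :: "('g, 'c) monoid_scheme" and R :: "('r, 'd) ring_scheme"
    and S :: "'g \<Rightarrow> 'r set" +
  assumes component_subgroup: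
      "g \<in> carrier G \<Longrightarrow> additive_subgroup (S g) R"
    and unique_decomposition:
      "r \<in> carrier R \<Longrightarrow>
        \<exists>!f. f \<in> (\<Pi>\<^sub>E g\<in>carrier G. S g) \<and> finite {g \<in> carrier G. f g \<noteq> \<zero>\<^bsub>R\<^esub>} \<and>
             r = (\<Oplus>\<^bsub>R\<^esub>g\<in>{g \<in> carrier G. f g \<noteq> \<zero>\<^bsub>R\<^esub>}. f g)"
    and component_mult:
      "\<lbrakk>g \<in> carrier G; h \<in> carrier G; x \<in> S g; y \<in> S h\<rbrakk> \<Longrightarrow> x \<otimes>\<^bsub>R\<^esub> y \<in> S (g \<otimes>\<^bsub>G\<^esub> h)"

definition sums_of_products :: "('r, 'd) ring_scheme \<Rightarrow> 'r set \<Rightarrow> 'r set \<Rightarrow> 'r set" where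
  "sums_of_products R A B =
    {(\<Oplus>\<^bsub>R\<^esub>i\<in>{..<n}. a i \<otimes>\<^bsub>R\<^esub> b i) | (n::nat) a b. a \<in> {..<n} \<rightarrow> A \<and> b \<in> {..<n} \<rightarrow> B}"

locale strongly_graded_ring = graded_ring +
  assumes strong:
    "\<lbrakk>g \<in> carrier G; h \<in> carrier G\<rbrakk> \<Longrightarrow> sums_of_products R (S g) (S h) = S (g \<otimes>\<^bsub>G\<^esub> h)"

definition commutant :: "('r, 'd) ring_scheme \<Rightarrow> 'r set \<Rightarrow> 'r set" where
  "commutant R A = {x \<in> carrier R. \<forall>y\<in>A. x \<otimes>\<^bsub>R\<^esub> y = y \<otimes>\<^bsub>R\<^esub> x}"

definition unit_decomposition ::
  "('g, 'c) monoid_scheme \<Rightarrow> ('r, 'd) ring_scheme \<Rightarrow> ('g \<Rightarrow> 'r set) \<Rightarrow> 'g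
    \<Rightarrow> nat \<times> (nat \<Rightarrow> 'r) \<times> (nat \<Rightarrow> 'r) \<Rightarrow> bool" where
  "unit_decomposition G R S g = (\<lambda>(n, a, b).
     a \<in> {..<n} \<rightarrow> S g \<and> b \<in> {..<n} \<rightarrow> S (inv\<^bsub>G\<^esub> g) \<and>
     \<one>\<^bsub>R\<^esub> = (\<Oplus>\<^bsub>R\<^esub>i\<in>{..<n}. a i \<otimes>\<^bsub>R\<^esub> b i))"

text \<open>The choice of decomposition is harmless on the commutant of the identity component: see
  \<open>unit_decomposition_exists\<close> and \<open>canonical_action_eq\<close> below.\<close>

definition canonical_action ::
  "('g, 'c) monoid_scheme \<Rightarrow> ('r, 'd) ring_scheme \<Rightarrow> ('g \<Rightarrow> 'r set) \<Rightarrow> 'g \<Rightarrow> 'r \<Rightarrow> 'r" where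
  "canonical_action G R S g x =
     (case (SOME d. unit_decomposition G R S g d) of (n, a, b) \<Rightarrow>
       (\<Oplus>\<^bsub>R\<^esub>i\<in>{..<n}. a i \<otimes>\<^bsub>R\<^esub> x \<otimes>\<^bsub>R\<^esub> b i))"

text \<open>As for the library's \<^const>\<open>ideal\<close>, ideals are two-sided; the zero ring counts as simple and
  as \<open>G\<close>-simple.\<close>

definition simple_ring :: "('r, 'd) ring_scheme \<Rightarrow> bool" where
  "simple_ring R \<longleftrightarrow> ring R \<and> (\<forall>I. ideal I R \<longrightarrow> I = {\<zero>\<^bsub>R\<^esub>} \<or> I = carrier R)"

definition G_invariant ::
  "('g, 'c) monoid_scheme \<Rightarrow> ('g \<Rightarrow> 'r \<Rightarrow> 'r) \<Rightarrow> 'r set \<Rightarrow> bool" where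
  "G_invariant G \<sigma> I \<longleftrightarrow> (\<forall>g\<in>carrier G. \<sigma> g ` I \<subseteq> I)"

definition G_simple_ring ::
  "('g, 'c) monoid_scheme \<Rightarrow> ('g \<Rightarrow> 'r \<Rightarrow> 'r) \<Rightarrow> ('r, 'd) ring_scheme \<Rightarrow> bool" where
  "G_simple_ring G \<sigma> A \<longleftrightarrow> ring A \<and>
     (\<forall>I. ideal I A \<and> G_invariant G \<sigma> I \<longrightarrow> I = {\<zero>\<^bsub>A\<^esub>} \<or> I = carrier A)"

lemma (in ring) commutant_subring:
  assumes "A \<subseteq> carrier R"
  shows "subring (commutant R A) R"
proof (rule subringI)
  fix h assume h: "h \<in> commutant R A"
  show "\<ominus> h \<in> commutant R A"
    using h assms by (auto simp: commutant_def l_minus r_minus subset_iff)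
next
  fix h k assume hk: "h \<in> commutant R A" "k \<in> commutant R A"
  then have c: "h \<in> carrier R" "k \<in> carrier R" by (auto simp: commutant_def)
  { fix y assume y: "y \<in> A"
    then have yc: "y \<in> carrier R" using assms by blast
    have "h \<otimes> y = y \<otimes> h" "k \<otimes> y = y \<otimes> k" using hk y by (auto simp: commutant_def)
    then have "h \<otimes> k \<otimes> y = y \<otimes> (h \<otimes> k)" using c yc by (metis m_assoc) }
  then show "h \<otimes> k \<in> commutant R A" using c by (auto simp: commutant_def)
  show "h \<oplus> k \<in> commutant R A"
    using hk c assms by (auto simp: commutant_def l_distr r_distr subset_iff)
qed (use assms in \<open>auto simp: commutant_def subset_iff\<close>)

lemma (in abelian_monoid) finsum_nat_swap:
  fixes n m :: nat
  assumes "\<And>i j. i < n \<Longrightarrow> j < m \<Longrightarrow> f i j \<in> carrier G"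
  shows "(\<Oplus>i\<in>{..<n}. \<Oplus>j\<in>{..<m}. f i j) = (\<Oplus>j\<in>{..<m}. \<Oplus>i\<in>{..<n}. f i j)"
  using assms
proof (induction n)
  case 0
  then show ?case by simp
next
  case (Suc n)
  have "(\<Oplus>i\<in>{..<Suc n}. \<Oplus>j\<in>{..<m}. f i j)
      = (\<Oplus>j\<in>{..<m}. f n j) \<oplus> (\<Oplus>i\<in>{..<n}. \<Oplus>j\<in>{..<m}. f i j)"
    unfolding lessThan_Suc using Suc.prems by (subst finsum_insert) (auto simp: Pi_def)
  also have "\<dots> = (\<Oplus>j\<in>{..<m}. f n j) \<oplus> (\<Oplus>j\<in>{..<m}. \<Oplus>i\<in>{..<n}. f i j)"
    using Suc.IH Suc.prems by simp
  also have "\<dots> = (\<Oplus>j\<in>{..<m}. f n j \<oplus> (\<Oplus>i\<in>{..<n}. f i j))"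
    using Suc.prems by (subst finsum_addf) (auto simp: Pi_def)
  also have "\<dots> = (\<Oplus>j\<in>{..<m}. \<Oplus>i\<in>{..<Suc n}. f i j)"
    using Suc.prems unfolding lessThan_Suc
    by (intro finsum_cong') (auto simp: Pi_def)
  finally show ?case .
qed

context graded_ring
begin

lemma component_subset: "g \<in> carrier G \<Longrightarrow> S g \<subseteq> carrier R"
  using component_subgroup additive_subgroup.a_subset by blast

lemma unit_decompositions_agree:
  assumes g: "g \<in> carrier G" and x: "x \<in> commutant R (S \<one>\<^bsub>G\<^esub>)"
    and d: "unit_decomposition G R S g (n, a, b)"
    and d': "unit_decomposition G R S g (m, a', b')"
  shows "(\<Oplus>\<^bsub>R\<^esub>i\<in>{..<n}. a i \<otimes>\<^bsub>R\<^esub> x \<otimes>\<^bsub>R\<^esub> b i) = (\<Oplus>\<^bsub>R\<^esub>j\<in>{..<m}. a' j \<otimes>\<^bsub>R\<^esub> x \<otimes>\<^bsub>R\<^esub> b' j)"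
proof -
  have S: "a i \<in> S g" "b i \<in> S (inv\<^bsub>G\<^esub> g)" if "i < n" for i
    using d that by (auto simp: unit_decomposition_def Pi_def)
  have S': "a' j \<in> S g" "b' j \<in> S (inv\<^bsub>G\<^esub> g)" if "j < m" for j
    using d' that by (auto simp: unit_decomposition_def Pi_def)
  have one: "\<one>\<^bsub>R\<^esub> = (\<Oplus>\<^bsub>R\<^esub>i\<in>{..<n}. a i \<otimes>\<^bsub>R\<^esub> b i)"
    and one': "\<one>\<^bsub>R\<^esub> = (\<Oplus>\<^bsub>R\<^esub>j\<in>{..<m}. a' j \<otimes>\<^bsub>R\<^esub> b' j)"
    using d d' by (auto simp: unit_decomposition_def)
  have C: "a i \<in> carrier R" "b i \<in> carrier R" if "i < n" for i
    using S[OF that] component_subset g by auto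
  have C': "a' j \<in> carrier R" "b' j \<in> carrier R" if "j < m" for j
    using S'[OF that] component_subset g by auto
  have xc: "x \<in> carrier R" using x by (simp add: commutant_def)
  have mid: "a i \<otimes>\<^bsub>R\<^esub> x \<otimes>\<^bsub>R\<^esub> b i \<otimes>\<^bsub>R\<^esub> (a' j \<otimes>\<^bsub>R\<^esub> b' j) = a i \<otimes>\<^bsub>R\<^esub> b i \<otimes>\<^bsub>R\<^esub> (a' j \<otimes>\<^bsub>R\<^esub> x \<otimes>\<^bsub>R\<^esub> b' j)"
    if "i < n" "j < m" for i j
  proof -
    have "b i \<otimes>\<^bsub>R\<^esub> a' j \<in> S \<one>\<^bsub>G\<^esub>"
      using component_mult[of "inv\<^bsub>G\<^esub> g" g] S(2)[OF that(1)] S'(1)[OF that(2)] g by simp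
    then have "x \<otimes>\<^bsub>R\<^esub> (b i \<otimes>\<^bsub>R\<^esub> a' j) = b i \<otimes>\<^bsub>R\<^esub> a' j \<otimes>\<^bsub>R\<^esub> x"
      using x by (simp add: commutant_def)
    then have "a i \<otimes>\<^bsub>R\<^esub> (x \<otimes>\<^bsub>R\<^esub> (b i \<otimes>\<^bsub>R\<^esub> a' j)) \<otimes>\<^bsub>R\<^esub> b' j = a i \<otimes>\<^bsub>R\<^esub> (b i \<otimes>\<^bsub>R\<^esub> a' j \<otimes>\<^bsub>R\<^esub> x) \<otimes>\<^bsub>R\<^esub> b' j"
      by simp
    then show ?thesis using C[OF that(1)] C'[OF that(2)] xc by (simp add: R.m_assoc)
  qed
  have "(\<Oplus>\<^bsub>R\<^esub>i\<in>{..<n}. a i \<otimes>\<^bsub>R\<^esub> x \<otimes>\<^bsub>R\<^esub> b i)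
      = (\<Oplus>\<^bsub>R\<^esub>i\<in>{..<n}. \<Oplus>\<^bsub>R\<^esub>j\<in>{..<m}. a i \<otimes>\<^bsub>R\<^esub> x \<otimes>\<^bsub>R\<^esub> b i \<otimes>\<^bsub>R\<^esub> (a' j \<otimes>\<^bsub>R\<^esub> b' j))"
  proof (intro R.finsum_cong')
    fix i assume "i \<in> {..<n}"
    then have i: "i < n" by simp
    have "a i \<otimes>\<^bsub>R\<^esub> x \<otimes>\<^bsub>R\<^esub> b i = a i \<otimes>\<^bsub>R\<^esub> x \<otimes>\<^bsub>R\<^esub> b i \<otimes>\<^bsub>R\<^esub> (\<Oplus>\<^bsub>R\<^esub>j\<in>{..<m}. a' j \<otimes>\<^bsub>R\<^esub> b' j)"
      using C[OF i] xc by (simp flip: one')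
    also have "\<dots> = (\<Oplus>\<^bsub>R\<^esub>j\<in>{..<m}. a i \<otimes>\<^bsub>R\<^esub> x \<otimes>\<^bsub>R\<^esub> b i \<otimes>\<^bsub>R\<^esub> (a' j \<otimes>\<^bsub>R\<^esub> b' j))"
      using C[OF i] C' xc by (intro R.finsum_rdistr) auto
    finally show "a i \<otimes>\<^bsub>R\<^esub> x \<otimes>\<^bsub>R\<^esub> b i = \<dots>" .
  qed (use C C' xc in \<open>auto intro!: R.finsum_closed\<close>)
  also have "\<dots> = (\<Oplus>\<^bsub>R\<^esub>j\<in>{..<m}. \<Oplus>\<^bsub>R\<^esub>i\<in>{..<n}. a i \<otimes>\<^bsub>R\<^esub> x \<otimes>\<^bsub>R\<^esub> b i \<otimes>\<^bsub>R\<^esub> (a' j \<otimes>\<^bsub>R\<^esub> b' j))"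
    using C C' xc by (intro R.finsum_nat_swap) auto
  also have "\<dots> = (\<Oplus>\<^bsub>R\<^esub>j\<in>{..<m}. a' j \<otimes>\<^bsub>R\<^esub> x \<otimes>\<^bsub>R\<^esub> b' j)"
  proof (intro R.finsum_cong')
    fix j assume "j \<in> {..<m}"
    then have j: "j < m" by simp
    have "(\<Oplus>\<^bsub>R\<^esub>i\<in>{..<n}. a i \<otimes>\<^bsub>R\<^esub> x \<otimes>\<^bsub>R\<^esub> b i \<otimes>\<^bsub>R\<^esub> (a' j \<otimes>\<^bsub>R\<^esub> b' j))
        = (\<Oplus>\<^bsub>R\<^esub>i\<in>{..<n}. a i \<otimes>\<^bsub>R\<^esub> b i \<otimes>\<^bsub>R\<^esub> (a' j \<otimes>\<^bsub>R\<^esub> x \<otimes>\<^bsub>R\<^esub> b' j))"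
      using C C'[OF j] xc mid[OF _ j] by (intro R.finsum_cong') auto
    also have "\<dots> = (\<Oplus>\<^bsub>R\<^esub>i\<in>{..<n}. a i \<otimes>\<^bsub>R\<^esub> b i) \<otimes>\<^bsub>R\<^esub> (a' j \<otimes>\<^bsub>R\<^esub> x \<otimes>\<^bsub>R\<^esub> b' j)"
      using C C'[OF j] xc by (intro R.finsum_ldistr[symmetric]) auto
    also have "\<dots> = a' j \<otimes>\<^bsub>R\<^esub> x \<otimes>\<^bsub>R\<^esub> b' j"
      using C'[OF j] xc by (simp flip: one)
    finally show "(\<Oplus>\<^bsub>R\<^esub>i\<in>{..<n}. a i \<otimes>\<^bsub>R\<^esub> x \<otimes>\<^bsub>R\<^esub> b i \<otimes>\<^bsub>R\<^esub> (a' j \<otimes>\<^bsub>R\<^esub> b' j)) = \<dots>" .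
  qed (use C' xc in auto)
  finally show ?thesis .
qed

lemma canonical_action_eq:
  assumes "g \<in> carrier G" "x \<in> commutant R (S \<one>\<^bsub>G\<^esub>)" "unit_decomposition G R S g (n, a, b)"
  shows "canonical_action G R S g x = (\<Oplus>\<^bsub>R\<^esub>i\<in>{..<n}. a i \<otimes>\<^bsub>R\<^esub> x \<otimes>\<^bsub>R\<^esub> b i)"
proof -
  obtain m a' b' where e: "(SOME d. unit_decomposition G R S g d) = (m, a', b')"
    by (metis prod_cases3)
  then have "unit_decomposition G R S g (m, a', b')"
    using someI[of "unit_decomposition G R S g", OF assms(3)] by simp
  then show ?thesis
    using unit_decompositions_agree[OF assms(1,2) _ assms(3)] e by (simp add: canonical_action_def)
qed

lemma one_in_identity_component: "\<one>\<^bsub>R\<^esub> \<in> S \<one>\<^bsub>G\<^esub>"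
proof -
  let ?supp = "\<lambda>f. {g \<in> carrier G. f g \<noteq> \<zero>\<^bsub>R\<^esub>}"
  obtain f where f: "f \<in> (\<Pi>\<^sub>E g\<in>carrier G. S g)" and fin: "finite (?supp f)"
    and sum: "\<one>\<^bsub>R\<^esub> = (\<Oplus>\<^bsub>R\<^esub>g\<in>?supp f. f g)"
    using unique_decomposition[OF R.one_closed] by blast
  have fS: "f g \<in> S g" if "g \<in> carrier G" for g using f that by blast
  have fR: "f g \<in> carrier R" if "g \<in> carrier G" for g
    using fS[OF that] component_subset[OF that] by blast
  have zero: "\<zero>\<^bsub>R\<^esub> \<in> S g" if "g \<in> carrier G" for g
    using component_subgroup[OF that] additive_subgroup.zero_closed by blast
  have right_unit: "r \<otimes>\<^bsub>R\<^esub> f \<one>\<^bsub>G\<^esub> = r" if h: "h \<in> carrier G" and r: "r \<in> S h" for h r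
  proof -
    have rR: "r \<in> carrier R" using h r component_subset by blast
    define f1 where "f1 = (\<lambda>k\<in>carrier G. r \<otimes>\<^bsub>R\<^esub> f (inv\<^bsub>G\<^esub> h \<otimes>\<^bsub>G\<^esub> k))"
    define f2 where "f2 = (\<lambda>k\<in>carrier G. if k = h then r else \<zero>\<^bsub>R\<^esub>)"
    have f1_shift: "f1 (h \<otimes>\<^bsub>G\<^esub> g) = r \<otimes>\<^bsub>R\<^esub> f g" if "g \<in> carrier G" for g
      using that h by (simp add: f1_def G.m_assoc[symmetric])
    have shift: "k = h \<otimes>\<^bsub>G\<^esub> (inv\<^bsub>G\<^esub> h \<otimes>\<^bsub>G\<^esub> k)" if "k \<in> carrier G" for k
      using that h by (simp add: G.m_assoc[symmetric])
    have f1S: "f1 k \<in> S k" if k: "k \<in> carrier G" for k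
      using component_mult[OF h _ r fS, of "inv\<^bsub>G\<^esub> h \<otimes>\<^bsub>G\<^esub> k"] shift[OF k] h k
      by (simp add: f1_def)
    have f1E: "f1 \<in> (\<Pi>\<^sub>E g\<in>carrier G. S g)"
      using f1S by (auto simp: f1_def)
    let ?T = "(\<lambda>g. h \<otimes>\<^bsub>G\<^esub> g) ` ?supp f"
    have sub: "?supp f1 \<subseteq> ?T"
    proof
      fix k assume k: "k \<in> ?supp f1"
      have "f (inv\<^bsub>G\<^esub> h \<otimes>\<^bsub>G\<^esub> k) \<noteq> \<zero>\<^bsub>R\<^esub>"
        using k rR by (auto simp: f1_def)
      then show "k \<in> ?T" using k shift h by (intro image_eqI[of _ _ "inv\<^bsub>G\<^esub> h \<otimes>\<^bsub>G\<^esub> k"]) auto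
    qed
    have TG: "?T \<subseteq> carrier G" using h by auto
    have f1R: "f1 k \<in> carrier R" if "k \<in> carrier G" for k
      using f1S[OF that] component_subset[OF that] by blast
    have "r = r \<otimes>\<^bsub>R\<^esub> (\<Oplus>\<^bsub>R\<^esub>g\<in>?supp f. f g)" using rR by (simp flip: sum)
    also have "\<dots> = (\<Oplus>\<^bsub>R\<^esub>g\<in>?supp f. r \<otimes>\<^bsub>R\<^esub> f g)"
      using fin rR fR by (intro R.finsum_rdistr) auto
    also have "\<dots> = (\<Oplus>\<^bsub>R\<^esub>g\<in>?supp f. f1 (h \<otimes>\<^bsub>G\<^esub> g))"
      using f1_shift rR fR h f1R by (intro R.finsum_cong') auto
    also have "\<dots> = (\<Oplus>\<^bsub>R\<^esub>k\<in>?T. f1 k)"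
      using h f1R by (intro R.add.finprod_reindex[symmetric]) (auto simp: inj_on_def)
    also have "\<dots> = (\<Oplus>\<^bsub>R\<^esub>k\<in>?supp f1. f1 k)"
      using sub TG fin f1R by (intro R.add.finprod_mono_neutral_cong_right) auto
    finally have s1: "r = (\<Oplus>\<^bsub>R\<^esub>k\<in>?supp f1. f1 k)" .
    have f2E: "f2 \<in> (\<Pi>\<^sub>E g\<in>carrier G. S g)"
      using r zero by (auto simp: f2_def)
    have supp2: "?supp f2 = (if r = \<zero>\<^bsub>R\<^esub> then {} else {h})"
      using h by (auto simp: f2_def)
    have s2: "r = (\<Oplus>\<^bsub>R\<^esub>k\<in>?supp f2. f2 k)"
      using rR h by (simp add: supp2) (simp add: f2_def)
    have fin1: "finite (?supp f1)" using finite_subset[OF sub] fin by simp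
    have fin2: "finite (?supp f2)" unfolding supp2 by simp
    obtain u where u: "\<And>f'. f' \<in> (\<Pi>\<^sub>E g\<in>carrier G. S g) \<Longrightarrow> finite (?supp f') \<Longrightarrow>
        r = (\<Oplus>\<^bsub>R\<^esub>g\<in>?supp f'. f' g) \<Longrightarrow> f' = u"
      using unique_decomposition[OF rR] by (elim ex1E) blast
    have "f1 = f2"
      using u[OF f1E fin1 s1] u[OF f2E fin2 s2] by simp
    then have "f1 h = r" using h by (simp add: f2_def)
    then show ?thesis using h by (simp add: f1_def)
  qed
  have "f \<one>\<^bsub>G\<^esub> = (\<Oplus>\<^bsub>R\<^esub>g\<in>?supp f. f g) \<otimes>\<^bsub>R\<^esub> f \<one>\<^bsub>G\<^esub>" using fR by (simp flip: sum)
  also have "\<dots> = (\<Oplus>\<^bsub>R\<^esub>g\<in>?supp f. f g \<otimes>\<^bsub>R\<^esub> f \<one>\<^bsub>G\<^esub>)"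
    using fin fR by (intro R.finsum_ldistr) auto
  also have "\<dots> = (\<Oplus>\<^bsub>R\<^esub>g\<in>?supp f. f g)"
    using right_unit fS fR by (intro R.finsum_cong') auto
  finally have "f \<one>\<^bsub>G\<^esub> = \<one>\<^bsub>R\<^esub>" using sum by simp
  then show ?thesis using fS[of "\<one>\<^bsub>G\<^esub>"] by simp
qed

end

lemma (in strongly_graded_ring) unit_decomposition_exists:
  assumes "g \<in> carrier G"
  shows "\<exists>d. unit_decomposition G R S g d"
proof -
  have "\<one>\<^bsub>R\<^esub> \<in> sums_of_products R (S g) (S (inv\<^bsub>G\<^esub> g))"
    using strong[of g "inv\<^bsub>G\<^esub> g"] one_in_identity_component assms by simp
  then show ?thesis
    by (auto simp: sums_of_products_def unit_decomposition_def)
qed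

end

theory Submission
  imports Defs
begin

text \<open>
  Write \<open>C\<close> for the commutant of the identity component \<open>S \<one>\<close>. The ring is simple because
  every nonzero ideal \<open>I\<close> meets \<open>C\<close> in a nonzero ideal of \<open>C\<close> that is invariant under the
  canonical action; \<open>G\<close>-simplicity then forces \<open>I \<inter> C = C\<close>, which contains the unit.

  Both halves rest on the fact that a component \<open>S g\<close> of a strongly graded ring is faithful:
  the unit is a sum of products from \<open>S g\<close> and \<open>S (inv g)\<close>, so an element that annihilates
  \<open>S g\<close> from the left annihilates the unit (\<open>component_faithful\<close>).

  \<^item> For the invariance, the canonical action is characterised by \<open>\<sigma>\<^sub>g(x) c = c x\<close> for all
    \<open>c \<in> S g\<close> (\<open>canonical_action_intertwines\<close>). This identity and faithfulness
    show that \<open>\<sigma>\<^sub>g(x)\<close> again commutes with \<open>S \<one>\<close> (\<open>canonical_action_closed\<close>).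
  \<^item> For the intersection (\<open>ideal_meets_commutant\<close>), take a nonzero element of \<open>I\<close> with the
    smallest possible number of homogeneous terms. Multiplying it by a suitable homogeneous element
    keeps it nonzero, by faithfulness, and shifts one of its terms to degree \<open>\<one>\<close>. As \<open>S \<one>\<close> is
    commutative, the commutator of the shifted element with any element of \<open>S \<one>\<close> has no term of
    degree \<open>\<one>\<close>. It lies in \<open>I\<close> and has fewer terms, so it vanishes by minimality.
\<close>

section \<open>Sums of homogeneous elements with prescribed degrees\<close>

text \<open>Zero terms are admitted, so \<open>T\<close> is only an upper bound for the support. Passing to a product
  or a commutator then acts on \<open>T\<close> by a formula, whichever terms happen to vanish.\<close>

definition homogeneous_sums ::
  "('r, 'd) ring_scheme \<Rightarrow> ('g \<Rightarrow> 'r set) \<Rightarrow> 'g set \<Rightarrow> 'r set" where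
  "homogeneous_sums R S T = {(\<Oplus>\<^bsub>R\<^esub>g\<in>T. f g) | f. f \<in> Pi T S}"

context graded_ring
begin

lemma component_carrier: "g \<in> carrier G \<Longrightarrow> x \<in> S g \<Longrightarrow> x \<in> carrier R"
  using component_subset by blast

lemma homogeneous_sum_exists:
  assumes "x \<in> carrier R"
  obtains T where "finite T" "T \<subseteq> carrier G" "x \<in> homogeneous_sums R S T"
proof -
  obtain f where f: "f \<in> (\<Pi>\<^sub>E g\<in>carrier G. S g)"
    and fin: "finite {g \<in> carrier G. f g \<noteq> \<zero>\<^bsub>R\<^esub>}"
    and x: "x = (\<Oplus>\<^bsub>R\<^esub>g\<in>{g \<in> carrier G. f g \<noteq> \<zero>\<^bsub>R\<^esub>}. f g)"
    using unique_decomposition[OF assms] by blast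
  show ?thesis
  proof (rule that[OF fin])
    show "x \<in> homogeneous_sums R S {g \<in> carrier G. f g \<noteq> \<zero>\<^bsub>R\<^esub>}"
      unfolding homogeneous_sums_def using f x by blast
  qed auto
qed

lemma homogeneous_sum_shift:
  assumes T: "finite T" "T \<subseteq> carrier G" and k: "k \<in> carrier G"
    and x: "x \<in> homogeneous_sums R S T" and c: "c \<in> S k"
  shows "x \<otimes>\<^bsub>R\<^esub> c \<in> homogeneous_sums R S ((\<lambda>g. g \<otimes>\<^bsub>G\<^esub> k) ` T)"
proof -
  obtain f where f: "f \<in> Pi T S" and x: "x = (\<Oplus>\<^bsub>R\<^esub>g\<in>T. f g)"
    using x by (auto simp: homogeneous_sums_def)
  define f' where "f' h = f (h \<otimes>\<^bsub>G\<^esub> inv\<^bsub>G\<^esub> k) \<otimes>\<^bsub>R\<^esub> c" for h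
  have cR: "c \<in> carrier R" using c k component_carrier by blast
  have fR: "f g \<in> carrier R" if "g \<in> T" for g
    using f T that component_carrier by blast
  have f'_shift: "f' (g \<otimes>\<^bsub>G\<^esub> k) = f g \<otimes>\<^bsub>R\<^esub> c" if "g \<in> T" for g
  proof -
    have "g \<in> carrier G" using that T by blast
    then show ?thesis using k by (simp add: f'_def G.m_assoc)
  qed
  have f'S: "f' \<in> Pi ((\<lambda>g. g \<otimes>\<^bsub>G\<^esub> k) ` T) S"
  proof
    fix h assume "h \<in> (\<lambda>g. g \<otimes>\<^bsub>G\<^esub> k) ` T"
    then obtain g where g: "g \<in> T" "h = g \<otimes>\<^bsub>G\<^esub> k" by blast
    have "g \<in> carrier G" "f g \<in> S g" using g T f by auto
    then show "f' h \<in> S h" using component_mult[OF _ k _ c] f'_shift g by simp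
  qed
  have inj: "inj_on (\<lambda>g. g \<otimes>\<^bsub>G\<^esub> k) T"
    by (rule inj_onI) (metis T(2) k G.right_cancel subsetD)
  have "x \<otimes>\<^bsub>R\<^esub> c = (\<Oplus>\<^bsub>R\<^esub>g\<in>T. f g \<otimes>\<^bsub>R\<^esub> c)"
    unfolding x using T cR fR by (intro R.finsum_ldistr) auto
  also have "\<dots> = (\<Oplus>\<^bsub>R\<^esub>g\<in>T. f' (g \<otimes>\<^bsub>G\<^esub> k))"
    using f'_shift cR fR by (intro R.finsum_cong') auto
  also have "\<dots> = (\<Oplus>\<^bsub>R\<^esub>h\<in>(\<lambda>g. g \<otimes>\<^bsub>G\<^esub> k) ` T. f' h)"
    using inj f'_shift cR fR by (intro R.add.finprod_reindex[symmetric]) auto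
  finally show ?thesis using f'S by (auto simp: homogeneous_sums_def)
qed

text \<open>Commutators with elements of degree \<open>\<one>\<close> preserve degrees, and the term of degree \<open>\<one>\<close> is a
  commutator inside the commutative identity component.\<close>

lemma commutator_loses_identity_term:
  assumes comm: "\<And>x y. x \<in> S \<one>\<^bsub>G\<^esub> \<Longrightarrow> y \<in> S \<one>\<^bsub>G\<^esub> \<Longrightarrow> x \<otimes>\<^bsub>R\<^esub> y = y \<otimes>\<^bsub>R\<^esub> x"
    and T: "finite T" "T \<subseteq> carrier G"
    and x: "x \<in> homogeneous_sums R S T" and y: "y \<in> S \<one>\<^bsub>G\<^esub>"
  shows "x \<otimes>\<^bsub>R\<^esub> y \<ominus>\<^bsub>R\<^esub> y \<otimes>\<^bsub>R\<^esub> x \<in> homogeneous_sums R S (T - {\<one>\<^bsub>G\<^esub>})"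
proof -
  obtain f where f: "f \<in> Pi T S" and x: "x = (\<Oplus>\<^bsub>R\<^esub>g\<in>T. f g)"
    using x by (auto simp: homogeneous_sums_def)
  have yR: "y \<in> carrier R" using y component_carrier by blast
  have fR: "f g \<in> carrier R" if "g \<in> T" for g
    using f T that component_carrier by blast
  define d where "d g = f g \<otimes>\<^bsub>R\<^esub> y \<oplus>\<^bsub>R\<^esub> (\<ominus>\<^bsub>R\<^esub> y) \<otimes>\<^bsub>R\<^esub> f g" for g
  have dR: "d g \<in> carrier R" if "g \<in> T" for g
    using fR[OF that] yR by (simp add: d_def)
  have my: "\<ominus>\<^bsub>R\<^esub> y \<in> S \<one>\<^bsub>G\<^esub>"
    using y additive_subgroup.a_inv_closed[OF component_subgroup] by simp
  have dS: "d g \<in> S g" if "g \<in> T" for g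
  proof -
    have g: "g \<in> carrier G" "f g \<in> S g" using that f T by auto
    have "f g \<otimes>\<^bsub>R\<^esub> y \<in> S g" "(\<ominus>\<^bsub>R\<^esub> y) \<otimes>\<^bsub>R\<^esub> f g \<in> S g"
      using component_mult[OF g(1) G.one_closed g(2) y]
        component_mult[OF G.one_closed g(1) my g(2)] g(1) by simp_all
    then show ?thesis
      unfolding d_def using additive_subgroup.a_closed[OF component_subgroup] g(1) by blast
  qed
  have d1: "d \<one>\<^bsub>G\<^esub> = \<zero>\<^bsub>R\<^esub>" if "\<one>\<^bsub>G\<^esub> \<in> T"
  proof -
    have "f \<one>\<^bsub>G\<^esub> \<in> S \<one>\<^bsub>G\<^esub>" using f that by blast
    then show ?thesis
      using comm[OF _ y] fR[OF that] yR by (simp add: d_def R.l_minus R.r_neg)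
  qed
  have "x \<otimes>\<^bsub>R\<^esub> y \<ominus>\<^bsub>R\<^esub> y \<otimes>\<^bsub>R\<^esub> x = x \<otimes>\<^bsub>R\<^esub> y \<oplus>\<^bsub>R\<^esub> (\<ominus>\<^bsub>R\<^esub> y) \<otimes>\<^bsub>R\<^esub> x"
    using x yR fR by (simp add: a_minus_def R.l_minus)
  also have "\<dots> = (\<Oplus>\<^bsub>R\<^esub>g\<in>T. f g \<otimes>\<^bsub>R\<^esub> y) \<oplus>\<^bsub>R\<^esub> (\<Oplus>\<^bsub>R\<^esub>g\<in>T. (\<ominus>\<^bsub>R\<^esub> y) \<otimes>\<^bsub>R\<^esub> f g)"
    unfolding x using T yR fR
    by (subst R.finsum_ldistr, simp_all, subst R.finsum_rdistr, auto)
  also have "\<dots> = (\<Oplus>\<^bsub>R\<^esub>g\<in>T. d g)"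
    unfolding d_def using yR fR by (intro R.finsum_addf[symmetric]) auto
  also have "\<dots> = (\<Oplus>\<^bsub>R\<^esub>g\<in>T - {\<one>\<^bsub>G\<^esub>}. d g)"
    using T dR d1 by (intro R.add.finprod_mono_neutral_cong_right) auto
  finally show ?thesis using dS by (auto simp: homogeneous_sums_def)
qed

end

section \<open>Faithful components and the canonical action\<close>

context strongly_graded_ring
begin

lemma component_faithful:
  assumes g: "g \<in> carrier G" and z: "z \<in> carrier R"
    and ann: "\<And>c. c \<in> S g \<Longrightarrow> z \<otimes>\<^bsub>R\<^esub> c = \<zero>\<^bsub>R\<^esub>"
  shows "z = \<zero>\<^bsub>R\<^esub>"
proof -
  obtain n a b where d: "unit_decomposition G R S g (n, a, b)"
    using unit_decomposition_exists[OF g] by (metis prod_cases3)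
  have a: "a i \<in> S g" and b: "b i \<in> S (inv\<^bsub>G\<^esub> g)" if "i < n" for i
    using d that by (auto simp: unit_decomposition_def Pi_def)
  have one: "\<one>\<^bsub>R\<^esub> = (\<Oplus>\<^bsub>R\<^esub>i\<in>{..<n}. a i \<otimes>\<^bsub>R\<^esub> b i)"
    using d by (simp add: unit_decomposition_def)
  have C: "a i \<in> carrier R" "b i \<in> carrier R" if "i < n" for i
    using component_carrier[OF g a[OF that]] component_carrier[OF _ b[OF that]] g by auto
  have "z = z \<otimes>\<^bsub>R\<^esub> (\<Oplus>\<^bsub>R\<^esub>i\<in>{..<n}. a i \<otimes>\<^bsub>R\<^esub> b i)" using z by (simp flip: one)
  also have "\<dots> = (\<Oplus>\<^bsub>R\<^esub>i\<in>{..<n}. z \<otimes>\<^bsub>R\<^esub> (a i \<otimes>\<^bsub>R\<^esub> b i))"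
    using z C by (intro R.finsum_rdistr) auto
  also have "\<dots> = (\<Oplus>\<^bsub>R\<^esub>i\<in>{..<n}. \<zero>\<^bsub>R\<^esub>)"
  proof (intro R.finsum_cong')
    fix i assume "i \<in> {..<n}"
    then have i: "i < n" by simp
    show "z \<otimes>\<^bsub>R\<^esub> (a i \<otimes>\<^bsub>R\<^esub> b i) = \<zero>\<^bsub>R\<^esub>"
      using ann[OF a[OF i]] C[OF i] z by (simp flip: R.m_assoc)
  qed auto
  finally show ?thesis by simp
qed

text \<open>In \<open>\<sigma>\<^sub>g(x) c = \<Sum> a\<^sub>i x b\<^sub>i c\<close> the factor \<open>b\<^sub>i c\<close> has degree \<open>\<one>\<close>, so \<open>x\<close> can be moved past it,
  and the sum collapses to \<open>c x\<close>.\<close>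

lemma canonical_action_intertwines:
  assumes g: "g \<in> carrier G" and x: "x \<in> commutant R (S \<one>\<^bsub>G\<^esub>)" and c: "c \<in> S g"
  shows "canonical_action G R S g x \<otimes>\<^bsub>R\<^esub> c = c \<otimes>\<^bsub>R\<^esub> x"
proof -
  obtain n a b where d: "unit_decomposition G R S g (n, a, b)"
    using unit_decomposition_exists[OF g] by (metis prod_cases3)
  have a: "a i \<in> S g" and b: "b i \<in> S (inv\<^bsub>G\<^esub> g)" if "i < n" for i
    using d that by (auto simp: unit_decomposition_def Pi_def)
  have one: "\<one>\<^bsub>R\<^esub> = (\<Oplus>\<^bsub>R\<^esub>i\<in>{..<n}. a i \<otimes>\<^bsub>R\<^esub> b i)"
    using d by (simp add: unit_decomposition_def)
  have C: "a i \<in> carrier R" "b i \<in> carrier R" if "i < n" for i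
    using component_carrier[OF g a[OF that]] component_carrier[OF _ b[OF that]] g by auto
  have cR: "c \<in> carrier R" using component_carrier[OF g c] .
  have xR: "x \<in> carrier R" using x by (simp add: commutant_def)
  have "canonical_action G R S g x \<otimes>\<^bsub>R\<^esub> c = (\<Oplus>\<^bsub>R\<^esub>i\<in>{..<n}. a i \<otimes>\<^bsub>R\<^esub> x \<otimes>\<^bsub>R\<^esub> b i) \<otimes>\<^bsub>R\<^esub> c"
    using canonical_action_eq[OF g x d] by simp
  also have "\<dots> = (\<Oplus>\<^bsub>R\<^esub>i\<in>{..<n}. a i \<otimes>\<^bsub>R\<^esub> x \<otimes>\<^bsub>R\<^esub> b i \<otimes>\<^bsub>R\<^esub> c)"
    using C cR xR by (intro R.finsum_ldistr) auto
  also have "\<dots> = (\<Oplus>\<^bsub>R\<^esub>i\<in>{..<n}. a i \<otimes>\<^bsub>R\<^esub> b i \<otimes>\<^bsub>R\<^esub> (c \<otimes>\<^bsub>R\<^esub> x))"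
  proof (intro R.finsum_cong')
    fix i assume "i \<in> {..<n}"
    then have i: "i < n" by simp
    have "b i \<otimes>\<^bsub>R\<^esub> c \<in> S \<one>\<^bsub>G\<^esub>"
      using component_mult[OF _ g b[OF i] c] g by simp
    then have "x \<otimes>\<^bsub>R\<^esub> (b i \<otimes>\<^bsub>R\<^esub> c) = b i \<otimes>\<^bsub>R\<^esub> c \<otimes>\<^bsub>R\<^esub> x"
      using x by (simp add: commutant_def)
    then have "a i \<otimes>\<^bsub>R\<^esub> (x \<otimes>\<^bsub>R\<^esub> (b i \<otimes>\<^bsub>R\<^esub> c)) = a i \<otimes>\<^bsub>R\<^esub> (b i \<otimes>\<^bsub>R\<^esub> c \<otimes>\<^bsub>R\<^esub> x)" by simp
    then show "a i \<otimes>\<^bsub>R\<^esub> x \<otimes>\<^bsub>R\<^esub> b i \<otimes>\<^bsub>R\<^esub> c = a i \<otimes>\<^bsub>R\<^esub> b i \<otimes>\<^bsub>R\<^esub> (c \<otimes>\<^bsub>R\<^esub> x)"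
      using C[OF i] cR xR by (simp add: R.m_assoc)
  qed (use C cR xR in auto)
  also have "\<dots> = (\<Oplus>\<^bsub>R\<^esub>i\<in>{..<n}. a i \<otimes>\<^bsub>R\<^esub> b i) \<otimes>\<^bsub>R\<^esub> (c \<otimes>\<^bsub>R\<^esub> x)"
    using C cR xR by (intro R.finsum_ldistr[symmetric]) auto
  also have "\<dots> = c \<otimes>\<^bsub>R\<^esub> x" using cR xR by (simp flip: one)
  finally show ?thesis .
qed

lemma canonical_action_in_ideal:
  assumes g: "g \<in> carrier G" and I: "ideal I R"
    and x: "x \<in> commutant R (S \<one>\<^bsub>G\<^esub>)" "x \<in> I"
  shows "canonical_action G R S g x \<in> I"
proof -
  interpret I: ideal I R by fact
  obtain n a b where d: "unit_decomposition G R S g (n, a, b)"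
    using unit_decomposition_exists[OF g] by (metis prod_cases3)
  have C: "a i \<in> carrier R" "b i \<in> carrier R" if "i < n" for i
    using d that g component_carrier[of g] component_carrier[of "inv\<^bsub>G\<^esub> g"]
    by (auto simp: unit_decomposition_def Pi_def)
  have "(\<Oplus>\<^bsub>R\<^esub>i\<in>{..<m}. a i \<otimes>\<^bsub>R\<^esub> x \<otimes>\<^bsub>R\<^esub> b i) \<in> I" if "m \<le> n" for m
    using that
  proof (induction m)
    case (Suc m)
    have t: "a i \<otimes>\<^bsub>R\<^esub> x \<otimes>\<^bsub>R\<^esub> b i \<in> I" if "i \<le> m" for i
      using that Suc.prems C x(2) I.I_l_closed I.I_r_closed by simp
    then show ?case
      using Suc I.a_closed I.a_subset unfolding lessThan_Suc
      by (subst R.finsum_insert) (auto simp: Pi_def)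
  qed simp
  then show ?thesis using canonical_action_eq[OF g x(1) d] by simp
qed

text \<open>For \<open>y \<in> S \<one>\<close> and \<open>c \<in> S g\<close> the product \<open>y c\<close> lies in \<open>S g\<close> as well, so both \<open>\<sigma>\<^sub>g(x) y c\<close> and
  \<open>y \<sigma>\<^sub>g(x) c\<close> equal \<open>y c x\<close>; the factor \<open>c\<close> cancels by faithfulness.\<close>

lemma canonical_action_closed:
  assumes g: "g \<in> carrier G" and x: "x \<in> commutant R (S \<one>\<^bsub>G\<^esub>)"
  shows "canonical_action G R S g x \<in> commutant R (S \<one>\<^bsub>G\<^esub>)"
proof -
  let ?s = "canonical_action G R S g x"
  have xR: "x \<in> carrier R" using x by (simp add: commutant_def)
  have sR: "?s \<in> carrier R"
    using canonical_action_in_ideal[OF g R.oneideal x xR] .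
  have "?s \<otimes>\<^bsub>R\<^esub> y = y \<otimes>\<^bsub>R\<^esub> ?s" if y: "y \<in> S \<one>\<^bsub>G\<^esub>" for y
  proof -
    have yR: "y \<in> carrier R" using component_carrier y by blast
    have "?s \<otimes>\<^bsub>R\<^esub> y \<ominus>\<^bsub>R\<^esub> y \<otimes>\<^bsub>R\<^esub> ?s = \<zero>\<^bsub>R\<^esub>"
    proof (rule component_faithful[OF g])
      fix c assume c: "c \<in> S g"
      have cR: "c \<in> carrier R" using component_carrier[OF g c] .
      have yc: "y \<otimes>\<^bsub>R\<^esub> c \<in> S g" using component_mult[OF _ g y c] g by simp
      have "?s \<otimes>\<^bsub>R\<^esub> y \<otimes>\<^bsub>R\<^esub> c = y \<otimes>\<^bsub>R\<^esub> c \<otimes>\<^bsub>R\<^esub> x"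
        using canonical_action_intertwines[OF g x yc] sR yR cR by (simp add: R.m_assoc)
      also have "\<dots> = y \<otimes>\<^bsub>R\<^esub> ?s \<otimes>\<^bsub>R\<^esub> c"
        using canonical_action_intertwines[OF g x c] sR yR cR xR by (simp add: R.m_assoc)
      finally show "(?s \<otimes>\<^bsub>R\<^esub> y \<ominus>\<^bsub>R\<^esub> y \<otimes>\<^bsub>R\<^esub> ?s) \<otimes>\<^bsub>R\<^esub> c = \<zero>\<^bsub>R\<^esub>"
        using sR yR cR by (simp add: a_minus_def R.l_distr R.l_minus R.r_neg)
    qed (use sR yR in simp)
    then show ?thesis using sR yR by simp
  qed
  then show ?thesis using sR by (simp add: commutant_def)
qed

section \<open>Ideals and the commutant of the identity component\<close>

text \<open>An element of \<open>I\<close> with fewest terms, one of them of degree \<open>\<one>\<close>, has to lie in the commutant: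
  each of its commutators with the identity component is a shorter element of \<open>I\<close>, hence zero.\<close>

lemma ideal_meets_commutant:
  assumes comm: "\<And>x y. x \<in> S \<one>\<^bsub>G\<^esub> \<Longrightarrow> y \<in> S \<one>\<^bsub>G\<^esub> \<Longrightarrow> x \<otimes>\<^bsub>R\<^esub> y = y \<otimes>\<^bsub>R\<^esub> x"
    and I: "ideal I R" "I \<noteq> {\<zero>\<^bsub>R\<^esub>}"
  obtains x where "x \<in> I" "x \<noteq> \<zero>\<^bsub>R\<^esub>" "x \<in> commutant R (S \<one>\<^bsub>G\<^esub>)"
proof -
  interpret I: ideal I R by fact
  let ?P = "\<lambda>T. finite T \<and> T \<subseteq> carrier G \<and> (\<exists>x\<in>I. x \<noteq> \<zero>\<^bsub>R\<^esub> \<and> x \<in> homogeneous_sums R S T)"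
  obtain x0 where x0: "x0 \<in> I" "x0 \<noteq> \<zero>\<^bsub>R\<^esub>"
    using I(2) I.zero_closed by blast
  have "x0 \<in> carrier R" using x0(1) I.a_subset by blast
  then obtain T0 where "finite T0" "T0 \<subseteq> carrier G" "x0 \<in> homogeneous_sums R S T0"
    by (rule homogeneous_sum_exists)
  then have "?P T0" using x0 by blast
  from ex_has_least_nat[of ?P, OF this, of card]
  obtain T where T: "?P T" and min: "\<And>T'. ?P T' \<Longrightarrow> card T \<le> card T'"
    by metis
  obtain r where r: "r \<in> I" "r \<noteq> \<zero>\<^bsub>R\<^esub>" "r \<in> homogeneous_sums R S T"
    using T by blast
  have rR: "r \<in> carrier R" using r(1) I.a_subset by blast
  have "T \<noteq> {}" using r(2,3) by (auto simp: homogeneous_sums_def)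
  then obtain g where gT: "g \<in> T" by blast
  have g: "g \<in> carrier G" using gT T by blast
  \<comment> \<open>Multiplication by \<open>c\<close> moves the term of degree \<open>g\<close> to degree \<open>\<one>\<close> and, by the choice of \<open>c\<close>,
    does not annihilate \<open>r\<close>; the shifted sum is again of minimal size.\<close>
  obtain c where c: "c \<in> S (inv\<^bsub>G\<^esub> g)" and rc: "r \<otimes>\<^bsub>R\<^esub> c \<noteq> \<zero>\<^bsub>R\<^esub>"
    using component_faithful[OF G.inv_closed[OF g] rR] r(2) by blast
  have cR: "c \<in> carrier R" using component_carrier[OF G.inv_closed[OF g] c] .
  let ?T = "(\<lambda>h. h \<otimes>\<^bsub>G\<^esub> inv\<^bsub>G\<^esub> g) ` T"
  let ?x = "r \<otimes>\<^bsub>R\<^esub> c"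
  have T': "finite ?T" "?T \<subseteq> carrier G" using T g by auto
  have one: "\<one>\<^bsub>G\<^esub> \<in> ?T" using gT g by (auto intro!: image_eqI[of _ _ g])
  have xI: "?x \<in> I" using I.I_r_closed r(1) cR by blast
  have xR: "?x \<in> carrier R" using rR cR by simp
  have xT: "?x \<in> homogeneous_sums R S ?T"
    using homogeneous_sum_shift[OF _ _ G.inv_closed[OF g] r(3) c] T by blast
  have smaller: "card (?T - {\<one>\<^bsub>G\<^esub>}) < card T"
    using card_Diff1_less[OF T'(1) one] card_image_le[of T "\<lambda>h. h \<otimes>\<^bsub>G\<^esub> inv\<^bsub>G\<^esub> g"] T by linarith
  have "?x \<otimes>\<^bsub>R\<^esub> y = y \<otimes>\<^bsub>R\<^esub> ?x" if y: "y \<in> S \<one>\<^bsub>G\<^esub>" for y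
  proof -
    have yR: "y \<in> carrier R" using component_carrier y by blast
    let ?d = "?x \<otimes>\<^bsub>R\<^esub> y \<ominus>\<^bsub>R\<^esub> y \<otimes>\<^bsub>R\<^esub> ?x"
    have dT: "?d \<in> homogeneous_sums R S (?T - {\<one>\<^bsub>G\<^esub>})"
      using commutator_loses_identity_term[OF comm T' xT y] by blast
    have dI: "?d \<in> I"
      unfolding a_minus_def
      by (intro I.a_closed I.a_inv_closed I.I_l_closed I.I_r_closed xI yR)
    have "?d = \<zero>\<^bsub>R\<^esub>"
    proof (rule ccontr)
      assume "?d \<noteq> \<zero>\<^bsub>R\<^esub>"
      then have "?P (?T - {\<one>\<^bsub>G\<^esub>})" using dT dI T' by blast
      then show False using min smaller by (meson not_le)
    qed
    then show ?thesis using R.r_right_minus_eq[of "?x \<otimes>\<^bsub>R\<^esub> y" "y \<otimes>\<^bsub>R\<^esub> ?x"] xR yR by blast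
  qed
  then show ?thesis using that[OF xI rc] xR by (simp add: commutant_def)
qed

end

lemma (in ring) ideal_Int_subring:
  assumes "ideal I R" "subring C R"
  shows "ideal (I \<inter> C) (R\<lparr>carrier := C\<rparr>)"
proof -
  interpret I: ideal I R by fact
  have CR: "C \<subseteq> carrier R" using subringE(1)[OF assms(2)] .
  show ?thesis
  proof (intro idealI)
    show "ring (R\<lparr>carrier := C\<rparr>)" using subring_is_ring[OF assms(2)] .
    interpret CC: ring "R\<lparr>carrier := C\<rparr>" by fact
    show "subgroup (I \<inter> C) (add_monoid (R\<lparr>carrier := C\<rparr>))"
    proof (rule CC.add.subgroupI)
      fix a assume a: "a \<in> I \<inter> C"
      have "\<ominus> a \<oplus> a = \<zero>" "\<ominus> a \<in> C" "a \<in> C"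
        using a CR subringE(5)[OF assms(2)] by (auto simp: l_neg subset_iff)
      then have "\<ominus>\<^bsub>R\<lparr>carrier := C\<rparr>\<^esub> a = \<ominus> a"
        using CC.minus_equality[of "\<ominus> a" a] by simp
      then show "\<ominus>\<^bsub>R\<lparr>carrier := C\<rparr>\<^esub> a \<in> I \<inter> C"
        using a subringE(5)[OF assms(2)] I.a_inv_closed by simp
    next
      show "I \<inter> C \<noteq> {}" using I.zero_closed subringE(2)[OF assms(2)] by blast
    qed (use I.a_closed subringE(7)[OF assms(2)] in auto)
  qed (use CR I.I_l_closed I.I_r_closed subringE(6)[OF assms(2)] in auto)
qed

theorem proposition6p6:
  fixes G :: "('g, 'c) monoid_scheme"
    and R :: "('r, 'd) ring_scheme"
    and S :: "'g \<Rightarrow> 'r set"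
  assumes "strongly_graded_ring G R S"
    and "\<And>x y. x \<in> S \<one>\<^bsub>G\<^esub> \<Longrightarrow> y \<in> S \<one>\<^bsub>G\<^esub> \<Longrightarrow> x \<otimes>\<^bsub>R\<^esub> y = y \<otimes>\<^bsub>R\<^esub> x"
    and "G_simple_ring G (canonical_action G R S) (R\<lparr>carrier := commutant R (S \<one>\<^bsub>G\<^esub>)\<rparr>)"
  shows "simple_ring R"
proof -
  interpret strongly_graded_ring G R S by fact
  let ?C = "commutant R (S \<one>\<^bsub>G\<^esub>)"
  have C: "subring ?C R" using R.commutant_subring component_subset by simp
  have "I = carrier R" if I: "ideal I R" and nz: "I \<noteq> {\<zero>\<^bsub>R\<^esub>}" for I
  proof -
    have "G_invariant G (canonical_action G R S) (I \<inter> ?C)"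
      using canonical_action_in_ideal[OF _ I] canonical_action_closed
      by (auto simp: G_invariant_def)
    then have "I \<inter> ?C = {\<zero>\<^bsub>R\<^esub>} \<or> I \<inter> ?C = ?C"
      using assms(3) R.ideal_Int_subring[OF I C] by (simp add: G_simple_ring_def)
    moreover have "I \<inter> ?C \<noteq> {\<zero>\<^bsub>R\<^esub>}"
      using ideal_meets_commutant[OF assms(2) I nz] by blast
    ultimately have "\<one>\<^bsub>R\<^esub> \<in> I" using subringE(3)[OF C] by blast
    then show ?thesis using ideal.one_imp_carrier[OF I] by blast
  qed
  then show ?thesis using R.ring_axioms by (auto simp: simple_ring_def)
qed

end
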